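(* Let $\eta\geq 3$ and $k\geq 1$ be integers, and let $\zeta_\eta:\{\xi\in\mathbb{Z}:\gcd(\xi,\eta)=1\}\to\{0,1\}$ be a function such that $\zeta_\eta(\theta_1)=\zeta_\eta(\theta_2)$ whenever $\gcd(\theta_1,\eta)=\gcd(\theta_2,\eta)=1$ and $\theta_1\equiv\theta_2\pmod{\eta}$. For $j=0,1$ let $A_j=\{a\in\mathbb{Z}:0<a<\eta,\ \gcd(a,\eta)=1,\ \zeta_\eta(a)=j\}$. Let $G$ be a graph of order $n$ and size $m$, let $H$ be a graph of order $k\eta$, and let $h:V(H)\to\{1,2,\ldots,k\eta\}$ be a bijection. Let $S=\{1,2,\ldots,nk\eta\}$, let $\phi$ be Euler's phi function, and let $$\Gamma_0=\{uv\in E(H):\gcd(h(u)+h(v),\eta)\neq 1\}\cup\{uv\in E(H):\gcd(h(u)+h(v),\eta)=1\text{ and }\zeta_\eta(h(u)+h(v))=0\},$$ $$\Gamma_1=\{uv\in E(H):\gcd(h(u)+h(v),\eta)=1\text{ and }\zeta_\eta(h(u)+h(v))=1\}.$$ (i) Let $\varpi(G\otimes H;h)=mk^2\eta[\eta-\phi(\eta)+|A_0|-|A_1|]+n[|\Gamma_0|-|\Gamma_1|]$. If $|\varpi(G\otimes H;h)|\leq 1$, then the lexicographic product $G\otimes H$ is an arithmetic cordial graph modulo $\eta$ under $\langle S,\zeta_\eta,+\rangle$. Moreover, if $\varpi(G\otimes H;h)$ equals $0$, $1$, or $-1$, then $G\otimes H$ is, respectively, a perfect, positive, or negative arithmetic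 cordial graph modulo $\eta$ under $\langle S,\zeta_\eta,+\rangle$. (ii) Let $\eta$ be odd and let $\varpi(G\square H;h)=mk[\eta-\phi(\eta)+|A_0|-|A_1|]+n[|\Gamma_0|-|\Gamma_1|]$. If $|\varpi(G\square H;h)|\leq 1$, then the cartesian product $G\square H$ is an arithmetic cordial graph modulo $\eta$ under $\langle S,\zeta_\eta,+\rangle$. Moreover, if $\varpi(G\square H;h)$ equals $0$, $1$, or $-1$, then $G\square H$ is, respectively, a perfect, positive, or negative arithmetic cordial graph modulo $\eta$ under $\langle S,\zeta_\eta,+\rangle$. (iii) If $h$ is a perfect arithmetic cordial labeling of $H$ modulo $\eta$ under $\langle S_1,\zeta_\eta,+\rangle$, where $S_1=\{1,2,\ldots,k\eta\}$, then the tensor product $G\times H$ is a perfect arithmetic cordial graph modulo $\eta$ under $\langle S,\zeta_\eta,+\rangle$. (iv) Let $\eta$ be odd and let $\varpi(G\boxtimes H;h)=mk[\eta-\phi(\eta)+|A_0|-|A_1|]+(n+2m)[|\Gamma_0|-|\Gamma_1|]$. If $|\varpi(G\boxtimes H;h)|\leq 1$, then the strong product $G\boxtimes H$ is an arithmetic cordial graph modulo $\eta$ under $\langle S,\zeta_\eta,+\rangle$. Moreover, if $\varpi(G\boxtimes H;h)$ equals $0$, $1$, or $-1$, then $G\boxtimes H$ is, respectively, a perfect, positive, or negative arithmetic cordial graph modulo $\eta$ under $\langle S,\zeta_\eta,+\rangle$.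
   Context: All graphs are finite and simple, not necessarily connected; the order of a graph is its number of vertices, the size its number of edges. Arithmetic cordial labeling: let $\eta$ be a positive integer, $G$ a graph with $n$ vertices, $S\subset\mathbb{Z}$ with $|S|=n$, $\star:S\times S\to\mathbb{Z}$ a binary function, and $\zeta_\eta:\{\xi\in\mathbb{Z}:\gcd(\xi,\eta)=1\}\to\{0,1\}$ a function. A bijection $f:V(G)\to S$ is an arithmetic cordial labeling modulo $\eta$ under $\langle S,\zeta_\eta,\star\rangle$ if the induced edge labeling $f_\eta^*:E(G)\to\{0,1\}$, given by $f_\eta^*(uv)=1$ if $\gcd(f(u)\star f(v),\eta)=1$ and $\zeta_\eta(f(u)\star f(v))=1$, and $f_\eta^*(uv)=0$ otherwise, satisfies $|e_{f_\eta^*}(0)-e_{f_\eta^*}(1)|\leq 1$, where $e_{f_\eta^*}(i)$ is the number of edges with label $i$. The labeling is called perfect, positive, or negative if $e_{f_\eta^*}(0)-e_{f_\eta^*}(1)$ equals $0$, $1$, or $-1$, respectively. A graph is a (perfect, positive, negative) arithmetic cordial graph modulo $\eta$ under $\langle S,\zeta_\eta,\star\rangle$ if it admits such a labeling. Here $\star$ is integer addition $+$. Products: all have vertex set $V(G)\times V(H)$. In the lexicographic product $G\otimes H$, $(v_1,u_1)(v_2,u_2)$ is an edge iff $v_1v_2\in E(G)$, or $v_1=v_2$ and $u_1u_2\in E(H)$. In the cartesian product $G\square H$, it is an edge iff $v_1=v_2$ and $u_1u_2\in E(H)$, or $u_1=u_2$ and $v_1v_2\in E(G)$. In the tensor product $G\times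 H$, it is an edge iff $v_1v_2\in E(G)$ and $u_1u_2\in E(H)$. The strong product has $E(G\boxtimes H)=E(G\square H)\cup E(G\times H)$. *)

theory Defs
  imports "HOL-Library.FuncSet" "HOL-Number_Theory.Number_Theory"
begin

record 'a ugraph =
  verts :: "'a set"
  edges :: "'a set set"

definition simple_graph :: "'a ugraph \<Rightarrow> bool" where
  "simple_graph G \<longleftrightarrow> finite (verts G) \<and> (\<forall>e\<in>edges G. e \<subseteq> verts G \<and> card e = 2)"

definition graph_order :: "'a ugraph \<Rightarrow> nat" where
  "graph_order G = card (verts G)"

definition graph_size :: "'a ugraph \<Rightarrow> nat" where
  "graph_size G = card (edges G)"

definition lex_product :: "'a ugraph \<Rightarrow> 'b ugraph \<Rightarrow> ('a \<times> 'b) ugraph" where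
  "lex_product G H = \<lparr>verts = verts G \<times> verts H,
     edges = {{(v1, u1), (v2, u2)} | v1 u1 v2 u2.
        (v1, u1) \<in> verts G \<times> verts H \<and> (v2, u2) \<in> verts G \<times> verts H \<and>
        ({v1, v2} \<in> edges G \<or> v1 = v2 \<and> {u1, u2} \<in> edges H)}\<rparr>"

definition cartesian_product :: "'a ugraph \<Rightarrow> 'b ugraph \<Rightarrow> ('a \<times> 'b) ugraph" where
  "cartesian_product G H = \<lparr>verts = verts G \<times> verts H,
     edges = {{(v1, u1), (v2, u2)} | v1 u1 v2 u2.
        (v1, u1) \<in> verts G \<times> verts H \<and> (v2, u2) \<in> verts G \<times> verts H \<and>
        (v1 = v2 \<and> {u1, u2} \<in> edges H \<or> u1 = u2 \<and> {v1, v2} \<in> edges G)}\<rparr>"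

definition tensor_product :: "'a ugraph \<Rightarrow> 'b ugraph \<Rightarrow> ('a \<times> 'b) ugraph" where
  "tensor_product G H = \<lparr>verts = verts G \<times> verts H,
     edges = {{(v1, u1), (v2, u2)} | v1 u1 v2 u2.
        (v1, u1) \<in> verts G \<times> verts H \<and> (v2, u2) \<in> verts G \<times> verts H \<and>
        {v1, v2} \<in> edges G \<and> {u1, u2} \<in> edges H}\<rparr>"

definition strong_product :: "'a ugraph \<Rightarrow> 'b ugraph \<Rightarrow> ('a \<times> 'b) ugraph" where
  "strong_product G H = \<lparr>verts = verts G \<times> verts H,
     edges = edges (cartesian_product G H) \<union> edges (tensor_product G H)\<rparr>"

lemma simple_graph_edge_neq: "simple_graph G \<Longrightarrow> {u, v} \<in> edges G \<Longrightarrow> u \<noteq> v"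
  by (auto simp: simple_graph_def)

lemma simple_graphI:
  assumes "finite V" and "\<And>e. e \<in> E \<Longrightarrow> \<exists>x y. e = {x, y} \<and> x \<in> V \<and> y \<in> V \<and> x \<noteq> y"
  shows "simple_graph \<lparr>verts = V, edges = E\<rparr>"
proof -
  have "e \<subseteq> V \<and> card e = 2" if "e \<in> E" for e
    using assms(2)[OF that] by (elim exE) simp
  then show ?thesis
    using assms(1) by (simp add: simple_graph_def)
qed

lemma simple_graph_products:
  assumes "simple_graph G" "simple_graph H"
  shows "simple_graph (lex_product G H)" "simple_graph (cartesian_product G H)"
    "simple_graph (tensor_product G H)" "simple_graph (strong_product G H)"
proof -
  have fin: "finite (verts G \<times> verts H)"
    using assms by (simp add: simple_graph_def)
  note neq = simple_graph_edge_neq[OF assms(1)] simple_graph_edge_neq[OF assms(2)]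
  show "simple_graph (lex_product G H)"
    unfolding lex_product_def
  proof (rule simple_graphI[OF fin], unfold mem_Collect_eq, elim exE conjE, goal_cases)
    case (1 e v1 u1 v2 u2)
    then have "(v1, u1) \<noteq> (v2, u2)" using neq by (metis Pair_inject)
    with 1 show ?case by metis
  qed
  show c: "simple_graph (cartesian_product G H)"
    unfolding cartesian_product_def
  proof (rule simple_graphI[OF fin], unfold mem_Collect_eq, elim exE conjE, goal_cases)
    case (1 e v1 u1 v2 u2)
    then have "(v1, u1) \<noteq> (v2, u2)" using neq by (metis Pair_inject)
    with 1 show ?case by metis
  qed
  show t: "simple_graph (tensor_product G H)"
    unfolding tensor_product_def
  proof (rule simple_graphI[OF fin], unfold mem_Collect_eq, elim exE conjE, goal_cases)
    case (1 e v1 u1 v2 u2)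
    then have "(v1, u1) \<noteq> (v2, u2)" using neq by (metis Pair_inject)
    with 1 show ?case by metis
  qed
  have "verts (cartesian_product G H) = verts G \<times> verts H"
    "verts (tensor_product G H) = verts G \<times> verts H"
    by (simp_all add: cartesian_product_def tensor_product_def)
  with c t show "simple_graph (strong_product G H)"
    unfolding simple_graph_def strong_product_def by auto
qed

text \<open>
  Edges are unordered, so the induced label of an edge is meaningful only if the operation gives
  the same label for both orders of its ends, as every commutative operation does; in that case
  the choice of \<open>u\<close> and \<open>v\<close> below is immaterial.  The values of \<open>\<zeta>\<close> at integers that are not
  coprime to \<open>\<eta>\<close> are never used.
\<close>

definition induced_label ::
  "nat \<Rightarrow> (int \<Rightarrow> nat) \<Rightarrow> (int \<Rightarrow> int \<Rightarrow> int) \<Rightarrow> ('a \<Rightarrow> int) \<Rightarrow> 'a set \<Rightarrow> nat" where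
  "induced_label \<eta> \<zeta> star f e =
     (if \<exists>u v. e = {u, v} \<and> gcd (star (f u) (f v)) (int \<eta>) = 1 \<and> \<zeta> (star (f u) (f v)) = 1
      then 1 else 0)"

definition edge_count :: "'a ugraph \<Rightarrow> ('a set \<Rightarrow> nat) \<Rightarrow> nat \<Rightarrow> nat" where
  "edge_count G l i = card {e \<in> edges G. l e = i}"

definition label_imbalance ::
  "nat \<Rightarrow> (int \<Rightarrow> nat) \<Rightarrow> (int \<Rightarrow> int \<Rightarrow> int) \<Rightarrow> 'a ugraph \<Rightarrow> ('a \<Rightarrow> int) \<Rightarrow> int" where
  "label_imbalance \<eta> \<zeta> star G f =
     int (edge_count G (induced_label \<eta> \<zeta> star f) 0)
     - int (edge_count G (induced_label \<eta> \<zeta> star f) 1)"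

definition ac_labeling ::
  "nat \<Rightarrow> int set \<Rightarrow> (int \<Rightarrow> nat) \<Rightarrow> (int \<Rightarrow> int \<Rightarrow> int) \<Rightarrow> 'a ugraph \<Rightarrow> ('a \<Rightarrow> int) \<Rightarrow> bool" where
  "ac_labeling \<eta> S \<zeta> star G f \<longleftrightarrow>
     bij_betw f (verts G) S \<and> \<bar>label_imbalance \<eta> \<zeta> star G f\<bar> \<le> 1"

definition perfect_ac_labeling ::
  "nat \<Rightarrow> int set \<Rightarrow> (int \<Rightarrow> nat) \<Rightarrow> (int \<Rightarrow> int \<Rightarrow> int) \<Rightarrow> 'a ugraph \<Rightarrow> ('a \<Rightarrow> int) \<Rightarrow> bool" where
  "perfect_ac_labeling \<eta> S \<zeta> star G f \<longleftrightarrow>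
     ac_labeling \<eta> S \<zeta> star G f \<and> label_imbalance \<eta> \<zeta> star G f = 0"

definition positive_ac_labeling ::
  "nat \<Rightarrow> int set \<Rightarrow> (int \<Rightarrow> nat) \<Rightarrow> (int \<Rightarrow> int \<Rightarrow> int) \<Rightarrow> 'a ugraph \<Rightarrow> ('a \<Rightarrow> int) \<Rightarrow> bool" where
  "positive_ac_labeling \<eta> S \<zeta> star G f \<longleftrightarrow>
     ac_labeling \<eta> S \<zeta> star G f \<and> label_imbalance \<eta> \<zeta> star G f = 1"

definition negative_ac_labeling ::
  "nat \<Rightarrow> int set \<Rightarrow> (int \<Rightarrow> nat) \<Rightarrow> (int \<Rightarrow> int \<Rightarrow> int) \<Rightarrow> 'a ugraph \<Rightarrow> ('a \<Rightarrow> int) \<Rightarrow> bool" where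
  "negative_ac_labeling \<eta> S \<zeta> star G f \<longleftrightarrow>
     ac_labeling \<eta> S \<zeta> star G f \<and> label_imbalance \<eta> \<zeta> star G f = -1"

definition ac_graph ::
  "nat \<Rightarrow> int set \<Rightarrow> (int \<Rightarrow> nat) \<Rightarrow> (int \<Rightarrow> int \<Rightarrow> int) \<Rightarrow> 'a ugraph \<Rightarrow> bool" where
  "ac_graph \<eta> S \<zeta> star G \<longleftrightarrow> (\<exists>f. ac_labeling \<eta> S \<zeta> star G f)"

definition perfect_ac_graph ::
  "nat \<Rightarrow> int set \<Rightarrow> (int \<Rightarrow> nat) \<Rightarrow> (int \<Rightarrow> int \<Rightarrow> int) \<Rightarrow> 'a ugraph \<Rightarrow> bool" where
  "perfect_ac_graph \<eta> S \<zeta> star G \<longleftrightarrow> (\<exists>f. perfect_ac_labeling \<eta> S \<zeta> star G f)"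

definition positive_ac_graph ::
  "nat \<Rightarrow> int set \<Rightarrow> (int \<Rightarrow> nat) \<Rightarrow> (int \<Rightarrow> int \<Rightarrow> int) \<Rightarrow> 'a ugraph \<Rightarrow> bool" where
  "positive_ac_graph \<eta> S \<zeta> star G \<longleftrightarrow> (\<exists>f. positive_ac_labeling \<eta> S \<zeta> star G f)"

definition negative_ac_graph ::
  "nat \<Rightarrow> int set \<Rightarrow> (int \<Rightarrow> nat) \<Rightarrow> (int \<Rightarrow> int \<Rightarrow> int) \<Rightarrow> 'a ugraph \<Rightarrow> bool" where
  "negative_ac_graph \<eta> S \<zeta> star G \<longleftrightarrow> (\<exists>f. negative_ac_labeling \<eta> S \<zeta> star G f)"

definition unit_class :: "nat \<Rightarrow> (int \<Rightarrow> nat) \<Rightarrow> nat \<Rightarrow> int set" where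
  "unit_class \<eta> \<zeta> j = {a. 0 < a \<and> a < int \<eta> \<and> gcd a (int \<eta>) = 1 \<and> \<zeta> a = j}"

definition Gamma0 :: "nat \<Rightarrow> (int \<Rightarrow> nat) \<Rightarrow> 'a ugraph \<Rightarrow> ('a \<Rightarrow> int) \<Rightarrow> 'a set set" where
  "Gamma0 \<eta> \<zeta> H h =
     {{u, v} | u v. {u, v} \<in> edges H \<and> gcd (h u + h v) (int \<eta>) \<noteq> 1} \<union>
     {{u, v} | u v. {u, v} \<in> edges H \<and> gcd (h u + h v) (int \<eta>) = 1 \<and> \<zeta> (h u + h v) = 0}"

definition Gamma1 :: "nat \<Rightarrow> (int \<Rightarrow> nat) \<Rightarrow> 'a ugraph \<Rightarrow> ('a \<Rightarrow> int) \<Rightarrow> 'a set set" where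
  "Gamma1 \<eta> \<zeta> H h =
     {{u, v} | u v. {u, v} \<in> edges H \<and> gcd (h u + h v) (int \<eta>) = 1 \<and> \<zeta> (h u + h v) = 1}"

end

theory Submission
  imports Defs
begin

text \<open>
  Give an edge the sign \<open>1\<close> or \<open>-1\<close> according to its label \<open>0\<close> or \<open>1\<close>, so that the
  imbalance of a labeling is the sum of the signs of the edges.  The sign of \<open>uv\<close> depends only on
  the residue of \<open>f(u) + f(v)\<close> modulo \<open>\<eta>\<close>.  Put the copies of \<open>H\<close> in the product one after
  another: the vertex \<open>(v, u)\<close> gets the label \<open>h(u) + b(v) k\<eta>\<close>, where \<open>b\<close> numbers the vertices of
  \<open>G\<close> from \<open>0\<close> to \<open>n - 1\<close>.  This is a bijection onto \<open>{1, \<dots>, nk\<eta>}\<close>, and the sign of an edge of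
  the product only sees the coordinates in \<open>H\<close>.

  Counting every edge in both directions turns the edge set of each product into a disjoint union
  of blocks \<open>P \<times> Q\<close>, with \<open>P\<close> a relation on \<open>V(G)\<close> (adjacency or equality) and \<open>Q\<close> a relation on
  \<open>V(H)\<close> (adjacency, equality, or the full relation).  A block contributes \<open>|P|\<close> times the sum of
  the signs over \<open>Q\<close> (\<open>sum_block\<close>).  Adjacency in \<open>H\<close> contributes twice \<open>|\<Gamma>\<^sub>0| - |\<Gamma>\<^sub>1|\<close>
  (\<open>sum_arcs_sign_eq_Gamma\<close>).  The other two relations lead to sums of \<open>sign(cx + a)\<close> over
  \<open>x \<in> {1, \<dots>, k\<eta>}\<close> with \<open>c\<close> coprime to \<open>\<eta>\<close>: \<open>c = 1\<close>, with one such sum for each of the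
  \<open>k\<eta>\<close> values of \<open>a\<close>, for the full relation, and \<open>c = 2\<close>, \<open>a = 0\<close> for equality, which is where
  \<open>\<eta>\<close> has to be odd.  As \<open>cx + a\<close> runs \<open>k\<close> times through all residues,
  each such sum is \<open>k\<close> times the sum of the signs over the residues, which is
  \<open>\<eta> - \<phi>(\<eta>) + |A\<^sub>0| - |A\<^sub>1|\<close>.  In the tensor product the only block is adjacency times adjacency,
  so its imbalance is \<open>2m\<close> times that of \<open>H\<close>, hence \<open>0\<close> if \<open>h\<close> is perfect.
\<close>

section \<open>Signs of residues\<close>

definition sign :: "nat \<Rightarrow> (int \<Rightarrow> nat) \<Rightarrow> int \<Rightarrow> int" where
  "sign \<eta> \<zeta> x = (if gcd x (int \<eta>) = 1 \<and> \<zeta> x = 1 then -1 else 1)"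

definition residue_invariant :: "nat \<Rightarrow> (int \<Rightarrow> nat) \<Rightarrow> bool" where
  "residue_invariant \<eta> \<zeta> \<longleftrightarrow> (\<forall>x y. gcd x (int \<eta>) = 1 \<longrightarrow> gcd y (int \<eta>) = 1 \<longrightarrow>
     [x = y] (mod int \<eta>) \<longrightarrow> \<zeta> x = \<zeta> y)"

lemma sign_cong:
  assumes "residue_invariant \<eta> \<zeta>" "[x = y] (mod int \<eta>)"
  shows "sign \<eta> \<zeta> x = sign \<eta> \<zeta> y"
proof -
  have g: "gcd x (int \<eta>) = gcd y (int \<eta>)"
    using assms(2) by (rule cong_gcd_eq)
  have "\<zeta> x = \<zeta> y" if "gcd x (int \<eta>) = 1"
    using assms(1)[unfolded residue_invariant_def, rule_format, OF that _ assms(2)] that g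
    by (simp only: simp_thms)
  then show ?thesis
    using g by (auto simp: sign_def)
qed

lemma sum_periodic:
  fixes g :: "int \<Rightarrow> int"
  assumes "\<And>x y. [x = y] (mod int \<eta>) \<Longrightarrow> g x = g y"
  shows "(\<Sum>x\<in>{1..int (k * \<eta>)}. g x) = int k * (\<Sum>r\<in>{0..<int \<eta>}. g r)"
proof (induction k)
  case 0
  then show ?case by simp
next
  case (Suc k)
  have split: "{1..int (Suc k * \<eta>)} = {1..int (k * \<eta>)} \<union> {int (k * \<eta>) + 1..int (k * \<eta>) + int \<eta>}"
  proof -
    have "int (Suc k * \<eta>) = int (k * \<eta>) + int \<eta>" and "0 \<le> int (k * \<eta>)" by simp_all
    then show ?thesis
      by (auto simp only: atLeastAtMost_iff Un_iff)
  qed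
  have "(\<Sum>x\<in>{int (k * \<eta>) + 1..int (k * \<eta>) + int \<eta>}. g x) = (\<Sum>r\<in>{0..<int \<eta>}. g r)"
  proof (cases "\<eta> = 0")
    case False
    have "(\<Sum>x\<in>{int (k * \<eta>) + 1..int (k * \<eta>) + int \<eta>}. g x) = (\<Sum>x\<in>{1..int \<eta>}. g x)"
      by (rule sum.reindex_bij_witness[where i = "\<lambda>x. x + int (k * \<eta>)"
            and j = "\<lambda>x. x - int (k * \<eta>)"])
        (auto intro!: assms simp: cong_iff_dvd_diff)
    \<comment> \<open>By periodicity the value at \<open>\<eta>\<close> can be exchanged for the value at \<open>0\<close>.\<close>
    also have "{1..int \<eta>} = insert (int \<eta>) {1..<int \<eta>}"
      using False by auto
    also have "sum g \<dots> = g 0 + sum g {1..<int \<eta>}"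
      using assms[of "int \<eta>" 0] by (simp add: cong_iff_dvd_diff)
    also have "\<dots> = sum g (insert 0 {1..<int \<eta>})"
      by simp
    also have "insert 0 {1..<int \<eta>} = {0..<int \<eta>}"
      using False by auto
    finally show ?thesis .
  qed simp
  moreover have "(\<Sum>x\<in>{1..int (Suc k * \<eta>)}. g x) =
      (\<Sum>x\<in>{1..int (k * \<eta>)}. g x) + (\<Sum>x\<in>{int (k * \<eta>) + 1..int (k * \<eta>) + int \<eta>}. g x)"
    unfolding split by (rule sum.union_disjoint) auto
  ultimately show ?case
    using Suc by (simp add: algebra_simps)
qed

text \<open>An affine map with a slope coprime to the modulus permutes the residues.\<close>

lemma sum_residues_affine:
  fixes g :: "int \<Rightarrow> int" and a c :: int
  assumes per: "\<And>x y. [x = y] (mod int \<eta>) \<Longrightarrow> g x = g y"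
    and pos: "\<eta> > 0" and cop: "coprime c (int \<eta>)"
  shows "(\<Sum>r\<in>{0..<int \<eta>}. g (c * r + a)) = (\<Sum>r\<in>{0..<int \<eta>}. g r)"
proof -
  define p where "p r = (c * r + a) mod int \<eta>" for r
  have inj: "inj_on p {0..<int \<eta>}"
  proof (rule inj_onI)
    fix r s assume rs: "r \<in> {0..<int \<eta>}" "s \<in> {0..<int \<eta>}" and "p r = p s"
    then have "[c * r + a = c * s + a] (mod int \<eta>)"
      by (simp add: p_def cong_def)
    then have "[r = s] (mod int \<eta>)"
      using cop by (simp add: cong_add_rcancel cong_mult_lcancel)
    then show "r = s"
      using rs by (simp add: cong_def)
  qed
  moreover have "p ` {0..<int \<eta>} \<subseteq> {0..<int \<eta>}"
    using pos by (auto simp: p_def)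
  ultimately have "bij_betw p {0..<int \<eta>} {0..<int \<eta>}"
    by (simp add: bij_betw_def endo_inj_surj)
  then have "(\<Sum>r\<in>{0..<int \<eta>}. g (p r)) = (\<Sum>r\<in>{0..<int \<eta>}. g r)"
    by (rule sum.reindex_bij_betw)
  moreover have "g (p r) = g (c * r + a)" for r
    by (rule per) (simp add: p_def cong_def)
  ultimately show ?thesis by simp
qed

text \<open>
  The signs of all residues add up to \<open>\<eta> - 2|A\<^sub>1|\<close>; the form below follows because the two unit
  classes together have \<open>\<phi>(\<eta>)\<close> elements.
\<close>

lemma sum_sign_residues:
  assumes "\<eta> > 1" and z: "\<And>x. gcd x (int \<eta>) = 1 \<Longrightarrow> \<zeta> x \<in> {0, 1}"
  shows "(\<Sum>r\<in>{0..<int \<eta>}. sign \<eta> \<zeta> r) =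
    int \<eta> - int (totient \<eta>) + int (card (unit_class \<eta> \<zeta> 0)) - int (card (unit_class \<eta> \<zeta> 1))"
proof -
  let ?A = "unit_class \<eta> \<zeta>"
  have fin: "finite (?A j)" for j
    by (rule finite_subset[of _ "{0..<int \<eta>}"]) (auto simp: unit_class_def)
  have "int ` totatives \<eta> = ?A 0 \<union> ?A 1"
  proof (intro equalityI subsetI)
    fix x assume "x \<in> int ` totatives \<eta>"
    then obtain j where j: "x = int j" "j \<in> totatives \<eta>" by auto
    then have g: "gcd x (int \<eta>) = 1"
      by (simp add: in_totatives_iff gcd_int_int_eq)
    have "0 < x" "x < int \<eta>"
      using j totatives_less[OF j(2) assms(1)] by (auto simp: in_totatives_iff)
    then show "x \<in> ?A 0 \<union> ?A 1"
      using g z[OF g] by (auto simp: unit_class_def)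
  next
    fix x assume "x \<in> ?A 0 \<union> ?A 1"
    then have x: "0 < x" "x < int \<eta>" "gcd x (int \<eta>) = 1"
      by (auto simp: unit_class_def)
    then have "coprime (int (nat x)) (int \<eta>)"
      by (simp add: coprime_iff_gcd_eq_1)
    then have "nat x \<in> totatives \<eta>"
      using x coprime_int_iff[of "nat x" \<eta>] by (simp add: in_totatives_iff nat_le_iff)
    then show "x \<in> int ` totatives \<eta>"
      using x by (intro image_eqI[of _ _ "nat x"]) auto
  qed
  then have "totient \<eta> = card (?A 0 \<union> ?A 1)"
    by (metis card_image inj_of_nat inj_on_subset subset_UNIV totient_def)
  also have "\<dots> = card (?A 0) + card (?A 1)"
    using fin by (intro card_Un_disjoint) (auto simp: unit_class_def)
  finally have tot: "totient \<eta> = card (?A 0) + card (?A 1)" .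
  have A1: "{r \<in> {0..<int \<eta>}. gcd r (int \<eta>) = 1 \<and> \<zeta> r = 1} = ?A 1"
    using assms(1) by (auto simp: unit_class_def le_less)
  have "(\<Sum>r\<in>{0..<int \<eta>}. sign \<eta> \<zeta> r) =
      (\<Sum>r\<in>{0..<int \<eta>}. 1 - 2 * (if gcd r (int \<eta>) = 1 \<and> \<zeta> r = 1 then 1 else 0))"
    by (rule sum.cong) (auto simp: sign_def)
  also have "\<dots> = int \<eta> - 2 * int (card (?A 1))"
    unfolding sum_subtractf sum_distrib_left[symmetric] A1[symmetric]
    by (simp add: sum.If_cases Int_def)
  finally show ?thesis
    using tot by simp
qed

section \<open>Imbalance as a sum over directed edges\<close>

definition arcs :: "'a ugraph \<Rightarrow> ('a \<times> 'a) set" where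
  "arcs G = {(x, y). {x, y} \<in> edges G}"

lemma arcs_subset: "simple_graph G \<Longrightarrow> arcs G \<subseteq> verts G \<times> verts G"
  by (auto simp: arcs_def simple_graph_def)

lemma arcs_irrefl: "simple_graph G \<Longrightarrow> (x, x) \<notin> arcs G"
  by (auto simp: arcs_def simple_graph_def)

lemma finite_arcs: "simple_graph G \<Longrightarrow> finite (arcs G)"
  by (rule finite_subset[OF arcs_subset]) (auto simp: simple_graph_def)

lemma finite_edges: "simple_graph G \<Longrightarrow> finite (edges G)"
  by (rule finite_subset[of _ "Pow (verts G)"]) (auto simp: simple_graph_def)

text \<open>
  Every edge arises from exactly two directed edges.  Directed edges are preferable because, unlike
  unordered pairs, they split into independent coordinates in the products.
\<close>

lemma sum_arcs_eq:
  fixes F :: "'a set \<Rightarrow> int"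
  assumes G: "simple_graph G"
  shows "(\<Sum>(x, y)\<in>arcs G. F {x, y}) = 2 * (\<Sum>e\<in>edges G. F e)"
proof -
  have "(\<Sum>(x, y)\<in>arcs G. F {x, y}) =
      (\<Sum>e\<in>edges G. \<Sum>(x, y)\<in>{p \<in> arcs G. (\<lambda>(x, y). {x, y}) p = e}. F {x, y})"
    by (rule sum.group[symmetric]) (use finite_arcs[OF G] finite_edges[OF G] in \<open>auto simp: arcs_def\<close>)
  also have "\<dots> = (\<Sum>e\<in>edges G. 2 * F e)"
  proof (rule sum.cong)
    fix e assume e: "e \<in> edges G"
    then have "card e = 2" using G by (simp add: simple_graph_def)
    then obtain a b where ab: "e = {a, b}" "a \<noteq> b"
      by (meson card_2_iff)
    have "{p \<in> arcs G. (\<lambda>(x, y). {x, y}) p = e} = {(a, b), (b, a)}"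
      using e ab by (auto simp: arcs_def doubleton_eq_iff insert_commute)
    then show "(\<Sum>(x, y)\<in>{p \<in> arcs G. (\<lambda>(x, y). {x, y}) p = e}. F {x, y}) = 2 * F e"
      using ab by (simp add: insert_commute)
  qed simp
  finally show ?thesis by (simp add: sum_distrib_left)
qed

lemma card_arcs: "simple_graph G \<Longrightarrow> int (card (arcs G)) = 2 * int (graph_size G)"
  using sum_arcs_eq[of G "\<lambda>_. 1"] by (simp add: graph_size_def case_prod_unfold)

text \<open>Commutativity of addition makes the label independent of the order of the two ends.\<close>

lemma induced_label_doubleton:
  "induced_label \<eta> \<zeta> (+) f {x, y} = (if sign \<eta> \<zeta> (f x + f y) = 1 then 0 else 1)"
proof -
  have "(\<exists>u v. {x, y} = {u, v} \<and> gcd (f u + f v) (int \<eta>) = 1 \<and> \<zeta> (f u + f v) = 1) \<longleftrightarrow>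
      gcd (f x + f y) (int \<eta>) = 1 \<and> \<zeta> (f x + f y) = 1"
    by (metis add.commute doubleton_eq_iff)
  then show ?thesis
    by (simp add: induced_label_def sign_def)
qed

lemma imbalance_eq_sum_arcs:
  assumes G: "simple_graph G"
  shows "2 * label_imbalance \<eta> \<zeta> (+) G f = (\<Sum>(x, y)\<in>arcs G. sign \<eta> \<zeta> (f x + f y))"
proof -
  define F where "F e = (if induced_label \<eta> \<zeta> (+) f e = 0 then 1 else -1 :: int)" for e
  have F: "F {x, y} = sign \<eta> \<zeta> (f x + f y)" for x y
    by (simp add: F_def induced_label_doubleton) (simp add: sign_def)
  have one: "induced_label \<eta> \<zeta> (+) f e = 1 \<longleftrightarrow> induced_label \<eta> \<zeta> (+) f e \<noteq> 0" for e
    by (simp add: induced_label_def)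
  have "label_imbalance \<eta> \<zeta> (+) G f = (\<Sum>e\<in>edges G. F e)"
    using finite_edges[OF G]
    by (simp only: label_imbalance_def edge_count_def one)
      (simp add: F_def sum.If_cases Int_def)
  then show ?thesis
    using sum_arcs_eq[OF G, of F] by (simp add: F)
qed

text \<open>
  \<open>\<Gamma>\<^sub>0\<close> and \<open>\<Gamma>\<^sub>1\<close> are the label classes of \<open>H\<close> under \<open>h\<close>.  They exhaust the edges because
  \<open>\<zeta>\<close> takes only the values \<open>0\<close> and \<open>1\<close> at units.
\<close>

lemma sum_arcs_sign_eq_Gamma:
  assumes H: "simple_graph H" and z: "\<And>x. gcd x (int \<eta>) = 1 \<Longrightarrow> \<zeta> x \<in> {0, 1}"
  shows "(\<Sum>(x, y)\<in>arcs H. sign \<eta> \<zeta> (h x + h y)) =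
    2 * (int (card (Gamma0 \<eta> \<zeta> H h)) - int (card (Gamma1 \<eta> \<zeta> H h)))"
proof -
  have edge: "\<exists>x y. e = {x, y}" if "e \<in> edges H" for e
  proof -
    have "card e = 2"
      using H that by (simp add: simple_graph_def)
    then show ?thesis
      by (meson card_2_iff)
  qed
  have edge_class: "{e \<in> edges H. P e} = {{u, v} | u v. {u, v} \<in> edges H \<and> P {u, v}}" for P
  proof (intro equalityI subsetI)
    fix e assume "e \<in> {e \<in> edges H. P e}"
    moreover from this obtain u v where "e = {u, v}"
      using edge by blast
    ultimately show "e \<in> {{u, v} | u v. {u, v} \<in> edges H \<and> P {u, v}}"
      by auto
  qed auto
  have label0: "induced_label \<eta> \<zeta> (+) h {u, v} = 0 \<longleftrightarrow> sign \<eta> \<zeta> (h u + h v) = 1"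
    and label1: "induced_label \<eta> \<zeta> (+) h {u, v} = 1 \<longleftrightarrow> sign \<eta> \<zeta> (h u + h v) \<noteq> 1" for u v
    by (simp_all add: induced_label_doubleton)
  have sign0: "sign \<eta> \<zeta> x = 1 \<longleftrightarrow> gcd x (int \<eta>) \<noteq> 1 \<or> gcd x (int \<eta>) = 1 \<and> \<zeta> x = 0"
    and sign1: "sign \<eta> \<zeta> x \<noteq> 1 \<longleftrightarrow> gcd x (int \<eta>) = 1 \<and> \<zeta> x = 1" for x
    using z[of x] by (auto simp: sign_def)
  have "Gamma0 \<eta> \<zeta> H h = {{u, v} | u v. {u, v} \<in> edges H \<and> sign \<eta> \<zeta> (h u + h v) = 1}"
    unfolding Gamma0_def sign0 by blast
  also have "\<dots> = {e \<in> edges H. induced_label \<eta> \<zeta> (+) h e = 0}"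
    unfolding edge_class label0 label1 by (rule refl)
  finally have 0: "Gamma0 \<eta> \<zeta> H h = {e \<in> edges H. induced_label \<eta> \<zeta> (+) h e = 0}" .
  have "Gamma1 \<eta> \<zeta> H h = {{u, v} | u v. {u, v} \<in> edges H \<and> sign \<eta> \<zeta> (h u + h v) \<noteq> 1}"
    unfolding Gamma1_def sign1 by (rule refl)
  also have "\<dots> = {e \<in> edges H. induced_label \<eta> \<zeta> (+) h e = 1}"
    unfolding edge_class label0 label1 by (rule refl)
  finally have "label_imbalance \<eta> \<zeta> (+) H h =
      int (card (Gamma0 \<eta> \<zeta> H h)) - int (card (Gamma1 \<eta> \<zeta> H h))"
    using 0 by (simp add: label_imbalance_def edge_count_def)
  then show ?thesis
    using imbalance_eq_sum_arcs[OF H, of \<eta> \<zeta> h] by simp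
qed

section \<open>Directed edges of the products\<close>

text \<open>
  The product of two relations, regarded as a relation on pairs; its elements are those of
  \<open>P \<times> Q\<close> with the two middle coordinates exchanged.
\<close>

definition block :: "('a \<times> 'a) set \<Rightarrow> ('b \<times> 'b) set \<Rightarrow> (('a \<times> 'b) \<times> ('a \<times> 'b)) set" where
  "block P Q = {((v1, u1), (v2, u2)). (v1, v2) \<in> P \<and> (u1, u2) \<in> Q}"

lemma block_eq_image: "block P Q = (\<lambda>((v1, v2), (u1, u2)). ((v1, u1), (v2, u2))) ` (P \<times> Q)"
  by (auto simp: block_def image_iff split: prod.splits) force

lemma finite_block: "finite P \<Longrightarrow> finite Q \<Longrightarrow> finite (block P Q)"
  by (simp add: block_eq_image)

lemma sum_block:
  fixes F :: "('a \<times> 'b) \<Rightarrow> ('a \<times> 'b) \<Rightarrow> int"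
  assumes "\<And>v1 v2 u1 u2. F (v1, u1) (v2, u2) = g u1 u2"
  shows "(\<Sum>(x, y)\<in>block P Q. F x y) = int (card P) * (\<Sum>(x, y)\<in>Q. g x y)"
proof -
  have "(\<Sum>(x, y)\<in>block P Q. F x y) = (\<Sum>(p, q)\<in>P \<times> Q. g (fst q) (snd q))"
    unfolding block_eq_image
    by (subst sum.reindex) (auto simp: inj_on_def assms case_prod_unfold)
  also have "\<dots> = (\<Sum>p\<in>P. \<Sum>q\<in>Q. g (fst q) (snd q))"
    by (rule sum.cartesian_product[symmetric])
  finally show ?thesis
    by (simp add: case_prod_unfold)
qed

text \<open>
  An unordered pair can be written in two ways, so reading adjacency off the edge set takes the
  symmetry of the defining relation.
\<close>

lemma arcs_of_symmetric:
  assumes "edges K = {{(v1, u1), (v2, u2)} | v1 u1 v2 u2. R v1 u1 v2 u2}"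
    and "\<And>v1 u1 v2 u2. R v1 u1 v2 u2 \<Longrightarrow> R v2 u2 v1 u1"
  shows "arcs K = {((v1, u1), (v2, u2)). R v1 u1 v2 u2}"
proof -
  have "{(v1, u1), (v2, u2)} \<in> edges K \<longleftrightarrow> R v1 u1 v2 u2" for v1 u1 v2 u2
    unfolding assms(1) mem_Collect_eq doubleton_eq_iff Pair_inject
    using assms(2) by blast
  then show ?thesis
    by (auto simp: arcs_def)
qed

lemma arcs_lex_product:
  assumes "simple_graph G" "simple_graph H"
  shows "arcs (lex_product G H) =
    block (arcs G) (verts H \<times> verts H) \<union> block (Id_on (verts G)) (arcs H)"
proof -
  have "arcs (lex_product G H) = {((v1, u1), (v2, u2)).
      (v1, u1) \<in> verts G \<times> verts H \<and> (v2, u2) \<in> verts G \<times> verts H \<and>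
      ({v1, v2} \<in> edges G \<or> v1 = v2 \<and> {u1, u2} \<in> edges H)}"
    by (rule arcs_of_symmetric) (auto simp: lex_product_def insert_commute)
  then show ?thesis
    using arcs_subset[OF assms(1)] arcs_subset[OF assms(2)]
    by (auto simp: arcs_def block_def)
qed

lemma arcs_cartesian_product:
  assumes "simple_graph G" "simple_graph H"
  shows "arcs (cartesian_product G H) =
    block (arcs G) (Id_on (verts H)) \<union> block (Id_on (verts G)) (arcs H)"
proof -
  have "arcs (cartesian_product G H) = {((v1, u1), (v2, u2)).
      (v1, u1) \<in> verts G \<times> verts H \<and> (v2, u2) \<in> verts G \<times> verts H \<and>
      (v1 = v2 \<and> {u1, u2} \<in> edges H \<or> u1 = u2 \<and> {v1, v2} \<in> edges G)}"
    by (rule arcs_of_symmetric) (auto simp: cartesian_product_def insert_commute)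
  then show ?thesis
    using arcs_subset[OF assms(1)] arcs_subset[OF assms(2)]
    by (auto simp: arcs_def block_def)
qed

lemma arcs_tensor_product:
  assumes "simple_graph G" "simple_graph H"
  shows "arcs (tensor_product G H) =
    block (arcs G) (arcs H)"
proof -
  have "arcs (tensor_product G H) = {((v1, u1), (v2, u2)).
      (v1, u1) \<in> verts G \<times> verts H \<and> (v2, u2) \<in> verts G \<times> verts H \<and>
      {v1, v2} \<in> edges G \<and> {u1, u2} \<in> edges H}"
    by (rule arcs_of_symmetric) (auto simp: tensor_product_def insert_commute)
  then show ?thesis
    using arcs_subset[OF assms(1)] arcs_subset[OF assms(2)]
    by (auto simp: arcs_def block_def)
qed

lemma arcs_strong_product:
  "arcs (strong_product G H) = arcs (cartesian_product G H) \<union> arcs (tensor_product G H)"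
  by (auto simp: arcs_def strong_product_def)

section \<open>Labeling the copies of the second factor consecutively\<close>

text \<open>
  The labels of one copy form an interval of length \<open>N\<close>, so division by \<open>N\<close> recovers the copy and
  the label inside it; surjectivity then follows by counting.
\<close>

lemma bij_betw_consecutive_copies:
  fixes h :: "'b \<Rightarrow> int" and b :: "'a \<Rightarrow> nat"
  assumes h: "bij_betw h U {1..int N}" and b: "bij_betw b V {0..<n}"
  shows "bij_betw (\<lambda>(v, u). h u + int (b v) * int N) (V \<times> U) {1..int (n * N)}"
proof -
  let ?f = "\<lambda>(v, u). h u + int (b v) * int N"
  have hr: "1 \<le> h u" "h u \<le> int N" if "u \<in> U" for u
    using bij_betwE[OF h] that by auto
  \<comment> \<open>The shift by one moves the labels of a copy into a full period of \<open>div\<close> and \<open>mod\<close>.\<close>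
  have div: "(h u - 1 + int (b v) * int N) div int N = int (b v)"
    and mod: "(h u - 1 + int (b v) * int N) mod int N = h u - 1" if "u \<in> U" for u v
    using hr[OF that] by simp_all
  have inj: "inj_on ?f (V \<times> U)"
  proof (rule inj_onI, clarify)
    fix v u v' u'
    assume m: "v \<in> V" "u \<in> U" "v' \<in> V" "u' \<in> U"
      and "h u + int (b v) * int N = h u' + int (b v') * int N"
    then have eq: "h u - 1 + int (b v) * int N = h u' - 1 + int (b v') * int N" by simp
    have "b v = b v'" "h u = h u'"
      using div[OF m(2), of v] div[OF m(4), of v'] mod[OF m(2), of v] mod[OF m(4), of v']
      unfolding eq by simp_all
    then show "v = v' \<and> u = u'"
      using m h b by (auto simp: bij_betw_def inj_on_def)
  qed
  have sub: "?f ` (V \<times> U) \<subseteq> {1..int (n * N)}"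
  proof clarify
    fix v u assume m: "v \<in> V" "u \<in> U"
    then have "b v + 1 \<le> n" using bij_betwE[OF b] by fastforce
    then have "(b v + 1) * N \<le> n * N" by (rule mult_le_mono1)
    then have "int (b v) * int N + int N \<le> int (n * N)"
      by (metis add_mult_distrib mult_1 of_nat_add of_nat_le_iff of_nat_mult)
    moreover have "0 \<le> int (b v) * int N" by simp
    ultimately show "h u + int (b v) * int N \<in> {1..int (n * N)}"
      using hr[OF m(2)] unfolding atLeastAtMost_iff by linarith
  qed
  have "card (V \<times> U) = card {1..int (n * N)}"
    using bij_betw_same_card[OF h] bij_betw_same_card[OF b]
    by (simp add: card_cartesian_product nat_mult_distrib)
  then have "?f ` (V \<times> U) = {1..int (n * N)}"
    using sub by (intro card_subset_eq) (simp_all add: card_image[OF inj])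
  then show ?thesis
    using inj by (simp add: bij_betw_def)
qed

lemma ac_graph_by_imbalance:
  assumes f: "bij_betw f (verts G) S" and "label_imbalance \<eta> \<zeta> star G f = w"
  shows "(\<bar>w\<bar> \<le> 1 \<longrightarrow> ac_graph \<eta> S \<zeta> star G) \<and>
    (w = 0 \<longrightarrow> perfect_ac_graph \<eta> S \<zeta> star G) \<and>
    (w = 1 \<longrightarrow> positive_ac_graph \<eta> S \<zeta> star G) \<and>
    (w = -1 \<longrightarrow> negative_ac_graph \<eta> S \<zeta> star G)"
  using assms
  unfolding ac_graph_def perfect_ac_graph_def positive_ac_graph_def negative_ac_graph_def
    perfect_ac_labeling_def positive_ac_labeling_def negative_ac_labeling_def ac_labeling_def
  by (intro conjI impI; intro exI[of _ f]; simp)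

theorem theorem3p2:
  fixes \<eta> k n m :: nat
    and \<zeta> :: "int \<Rightarrow> nat"
    and G :: "'a ugraph"
    and H :: "'b ugraph"
    and h :: "'b \<Rightarrow> int"
    and S :: "int set"
    and A :: "nat \<Rightarrow> int set"
    and \<Gamma>\<^sub>0 \<Gamma>\<^sub>1 :: "'b set set"
  assumes "\<eta> \<ge> 3" and "k \<ge> 1"
    and "\<zeta> \<in> {\<xi>. gcd \<xi> (int \<eta>) = 1} \<rightarrow> {0, 1}"
    and "\<And>\<theta>\<^sub>1 \<theta>\<^sub>2. gcd \<theta>\<^sub>1 (int \<eta>) = 1 \<Longrightarrow> gcd \<theta>\<^sub>2 (int \<eta>) = 1 \<Longrightarrow>
           [\<theta>\<^sub>1 = \<theta>\<^sub>2] (mod int \<eta>) \<Longrightarrow> \<zeta> \<theta>\<^sub>1 = \<zeta> \<theta>\<^sub>2"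
    and "simple_graph G" and "graph_order G = n" and "graph_size G = m"
    and "simple_graph H" and "graph_order H = k * \<eta>"
    and "bij_betw h (verts H) {1..int (k * \<eta>)}"
    and "S = {1..int (n * k * \<eta>)}"
    and "A = unit_class \<eta> \<zeta>"
    and "\<Gamma>\<^sub>0 = Gamma0 \<eta> \<zeta> H h" and "\<Gamma>\<^sub>1 = Gamma1 \<eta> \<zeta> H h"
  shows "(let \<omega> = int m * int k ^ 2 * int \<eta> *
                (int \<eta> - int (totient \<eta>) + int (card (A 0)) - int (card (A 1)))
              + int n * (int (card \<Gamma>\<^sub>0) - int (card \<Gamma>\<^sub>1))
         in (\<bar>\<omega>\<bar> \<le> 1 \<longrightarrow> ac_graph \<eta> S \<zeta> (+) (lex_product G H)) \<and>
            (\<omega> = 0 \<longrightarrow> perfect_ac_graph \<eta> S \<zeta> (+) (lex_product G H)) \<and>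
            (\<omega> = 1 \<longrightarrow> positive_ac_graph \<eta> S \<zeta> (+) (lex_product G H)) \<and>
            (\<omega> = -1 \<longrightarrow> negative_ac_graph \<eta> S \<zeta> (+) (lex_product G H))) \<and>
         (odd \<eta> \<longrightarrow>
         (let \<omega> = int m * int k *
                (int \<eta> - int (totient \<eta>) + int (card (A 0)) - int (card (A 1)))
              + int n * (int (card \<Gamma>\<^sub>0) - int (card \<Gamma>\<^sub>1))
         in (\<bar>\<omega>\<bar> \<le> 1 \<longrightarrow> ac_graph \<eta> S \<zeta> (+) (cartesian_product G H)) \<and>
            (\<omega> = 0 \<longrightarrow> perfect_ac_graph \<eta> S \<zeta> (+) (cartesian_product G H)) \<and>
            (\<omega> = 1 \<longrightarrow> positive_ac_graph \<eta> S \<zeta> (+) (cartesian_product G H)) \<and>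
            (\<omega> = -1 \<longrightarrow> negative_ac_graph \<eta> S \<zeta> (+) (cartesian_product G H)))) \<and>
         (perfect_ac_labeling \<eta> {1..int (k * \<eta>)} \<zeta> (+) H h \<longrightarrow>
         perfect_ac_graph \<eta> S \<zeta> (+) (tensor_product G H)) \<and>
         (odd \<eta> \<longrightarrow>
         (let \<omega> = int m * int k *
                (int \<eta> - int (totient \<eta>) + int (card (A 0)) - int (card (A 1)))
              + (int n + 2 * int m) * (int (card \<Gamma>\<^sub>0) - int (card \<Gamma>\<^sub>1))
         in (\<bar>\<omega>\<bar> \<le> 1 \<longrightarrow> ac_graph \<eta> S \<zeta> (+) (strong_product G H)) \<and>
            (\<omega> = 0 \<longrightarrow> perfect_ac_graph \<eta> S \<zeta> (+) (strong_product G H)) \<and>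
            (\<omega> = 1 \<longrightarrow> positive_ac_graph \<eta> S \<zeta> (+) (strong_product G H)) \<and>
            (\<omega> = -1 \<longrightarrow> negative_ac_graph \<eta> S \<zeta> (+) (strong_product G H))))"
proof -
  have z: "\<And>x. gcd x (int \<eta>) = 1 \<Longrightarrow> \<zeta> x \<in> {0, 1}"
    using funcset_mem[OF assms(3)] by (simp only: mem_Collect_eq)
  note G = \<open>simple_graph G\<close> and H = \<open>simple_graph H\<close>
  have inv: "residue_invariant \<eta> \<zeta>"
    unfolding residue_invariant_def using assms(4) by blast
  note sgn = sign_cong[OF inv]
  have finG: "finite (verts G)" and finH: "finite (verts H)"
    using G H by (simp_all add: simple_graph_def)
  define C where
    "C = int \<eta> - int (totient \<eta>) + int (card (A 0)) - int (card (A 1))"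
  define D where "D = int (card \<Gamma>\<^sub>0) - int (card \<Gamma>\<^sub>1)"

  have affine: "(\<Sum>u\<in>verts H. sign \<eta> \<zeta> (c * h u + a)) = int k * C"
    if "coprime c (int \<eta>)" for c a
  proof -
    have "[c * x + a = c * y + a] (mod int \<eta>)" if "[x = y] (mod int \<eta>)" for x y
      using that by (intro cong_add cong_mult cong_refl)
    then have per: "sign \<eta> \<zeta> (c * x + a) = sign \<eta> \<zeta> (c * y + a)" if "[x = y] (mod int \<eta>)" for x y
      using that by (intro sgn)
    have "(\<Sum>u\<in>verts H. sign \<eta> \<zeta> (c * h u + a)) =
        (\<Sum>x\<in>{1..int (k * \<eta>)}. sign \<eta> \<zeta> (c * x + a))"
      using assms(10) by (rule sum.reindex_bij_betw)
    also have "\<dots> = int k * (\<Sum>r\<in>{0..<int \<eta>}. sign \<eta> \<zeta> (c * r + a))"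
      by (rule sum_periodic[OF per])
    also have "(\<Sum>r\<in>{0..<int \<eta>}. sign \<eta> \<zeta> (c * r + a)) = (\<Sum>r\<in>{0..<int \<eta>}. sign \<eta> \<zeta> r)"
      using assms(1) that by (intro sum_residues_affine sgn) auto
    also have "\<dots> = C"
      using sum_sign_residues[OF _ z, of \<eta>] assms(1) by (simp add: C_def assms(12))
    finally show ?thesis .
  qed
  have full: "(\<Sum>(x, y)\<in>verts H \<times> verts H. sign \<eta> \<zeta> (h x + h y)) = int k ^ 2 * int \<eta> * C"
  proof -
    have "(\<Sum>(x, y)\<in>verts H \<times> verts H. sign \<eta> \<zeta> (h x + h y)) =
        (\<Sum>x\<in>verts H. \<Sum>y\<in>verts H. sign \<eta> \<zeta> (1 * h y + h x))"
      by (simp add: sum.cartesian_product[symmetric] add.commute)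
    also have "\<dots> = int (graph_order H) * (int k * C)"
      by (simp only: affine coprime_1_left sum_constant graph_order_def)
    finally show ?thesis
      by (simp add: assms(9) power2_eq_square)
  qed
  have diag: "(\<Sum>(x, y)\<in>Id_on (verts H). sign \<eta> \<zeta> (h x + h y)) = int k * C" if "odd \<eta>"
  proof -
    have "Id_on (verts H) = (\<lambda>x. (x, x)) ` verts H" by auto
    then have "(\<Sum>(x, y)\<in>Id_on (verts H). sign \<eta> \<zeta> (h x + h y)) =
        (\<Sum>x\<in>verts H. sign \<eta> \<zeta> (2 * h x + 0))"
      by (simp add: sum.reindex inj_on_def)
    also have "\<dots> = int k * C"
      using that by (intro affine) simp
    finally show ?thesis .
  qed
  have adj: "(\<Sum>(x, y)\<in>arcs H. sign \<eta> \<zeta> (h x + h y)) = 2 * D"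
    using sum_arcs_sign_eq_Gamma[OF H z] by (simp add: D_def assms(13,14))

  obtain b where b: "bij_betw b (verts G) {0..<n}"
    using ex_bij_betw_finite_nat[OF finG] assms(6) by (auto simp: graph_order_def)
  define f where "f = (\<lambda>(v, u). h u + int (b v) * int (k * \<eta>))"
  have bij: "bij_betw f (verts G \<times> verts H) S"
    using bij_betw_consecutive_copies[OF assms(10) b]
    by (simp add: f_def assms(11) mult.assoc)
  have f_sign: "sign \<eta> \<zeta> (f (v1, u1) + f (v2, u2)) = sign \<eta> \<zeta> (h u1 + h u2)" for v1 u1 v2 u2
    by (rule sgn) (auto simp: f_def cong_iff_dvd_diff intro!: dvd_add)
  have card_diag: "card (Id_on (verts G)) = n"
  proof -
    have "Id_on (verts G) = (\<lambda>x. (x, x)) ` verts G" by auto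
    then show ?thesis
      using assms(6) by (simp add: card_image inj_on_def graph_order_def)
  qed
  have card_adj: "int (card (arcs G)) = 2 * int m"
    using card_arcs[OF G] assms(7) by simp
  have fin: "finite (arcs G)" "finite (arcs H)" "finite (Id_on (verts G))"
    "finite (Id_on (verts H))" "finite (verts H \<times> verts H)"
    using finG finH
    by (auto simp: finite_arcs G H Id_on_def)
  let ?s = "\<lambda>B. \<Sum>(x, y)\<in>B. sign \<eta> \<zeta> (f x + f y)"
  have block_sum: "?s (block P Q) = int (card P) * (\<Sum>(x, y)\<in>Q. sign \<eta> \<zeta> (h x + h y))" for P Q
    by (rule sum_block) (rule f_sign)
  \<comment> \<open>Simple graphs have no loops, so adjacency and equality exclude each other.\<close>
  have disj: "block (arcs G) Q \<inter> block (Id_on (verts G)) Q' = {}"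
    "block P (Id_on (verts H)) \<inter> block P' (arcs H) = {}" for P P' Q Q'
    using arcs_irrefl[OF G] arcs_irrefl[OF H] by (auto simp: block_def)

  have lex: "?s (arcs (lex_product G H)) = 2 * (int m * int k ^ 2 * int \<eta> * C + int n * D)"
    unfolding arcs_lex_product[OF G H]
    by (subst sum.union_disjoint)
      (simp_all add: finite_block fin disj block_sum full adj card_diag card_adj algebra_simps)
  have cart: "?s (arcs (cartesian_product G H)) = 2 * (int m * int k * C + int n * D)" if "odd \<eta>"
    unfolding arcs_cartesian_product[OF G H]
    by (subst sum.union_disjoint)
      (simp_all add: finite_block fin disj block_sum diag[OF that] adj card_diag card_adj
        algebra_simps)
  have tensor: "?s (arcs (tensor_product G H)) = 2 * (2 * int m * D)"
    unfolding arcs_tensor_product[OF G H]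
    by (simp add: block_sum adj card_adj)
  have "arcs (cartesian_product G H) \<inter> arcs (tensor_product G H) = {}"
    unfolding arcs_cartesian_product[OF G H] arcs_tensor_product[OF G H]
    using disj by blast
  then have strong: "?s (arcs (strong_product G H)) =
      2 * (int m * int k * C + (int n + 2 * int m) * D)" if "odd \<eta>"
    unfolding arcs_strong_product
    by (subst sum.union_disjoint)
      (simp_all add: finite_arcs simple_graph_products G H cart[OF that] tensor algebra_simps)
  have verts: "verts (lex_product G H) = verts G \<times> verts H"
    "verts (cartesian_product G H) = verts G \<times> verts H"
    "verts (tensor_product G H) = verts G \<times> verts H"
    "verts (strong_product G H) = verts G \<times> verts H"
    by (simp_all add: lex_product_def cartesian_product_def tensor_product_def strong_product_def)
  have concl: "(\<bar>w\<bar> \<le> 1 \<longrightarrow> ac_graph \<eta> S \<zeta> (+) K) \<and>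
      (w = 0 \<longrightarrow> perfect_ac_graph \<eta> S \<zeta> (+) K) \<and>
      (w = 1 \<longrightarrow> positive_ac_graph \<eta> S \<zeta> (+) K) \<and>
      (w = -1 \<longrightarrow> negative_ac_graph \<eta> S \<zeta> (+) K)"
    if "simple_graph K" "verts K = verts G \<times> verts H" "?s (arcs K) = 2 * w" for K w
  proof (rule ac_graph_by_imbalance)
    show "bij_betw f (verts K) S"
      using bij that(2) by simp
    show "label_imbalance \<eta> \<zeta> (+) K f = w"
      using imbalance_eq_sum_arcs[OF that(1), of \<eta> \<zeta> f] that(3) by simp
  qed
  have "perfect_ac_graph \<eta> S \<zeta> (+) (tensor_product G H)"
    if "perfect_ac_labeling \<eta> {1..int (k * \<eta>)} \<zeta> (+) H h"
  proof -
    have "label_imbalance \<eta> \<zeta> (+) H h = 0"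
      using that by (simp add: perfect_ac_labeling_def)
    then have "D = 0"
      using imbalance_eq_sum_arcs[OF H, of \<eta> \<zeta> h] adj by simp
    then show ?thesis
      using concl[OF simple_graph_products(3)[OF G H] verts(3) tensor] by simp
  qed
  then show ?thesis
    unfolding Let_def C_def[symmetric] D_def[symmetric]
    using concl[OF simple_graph_products(1)[OF G H] verts(1) lex]
      concl[OF simple_graph_products(2)[OF G H] verts(2) cart]
      concl[OF simple_graph_products(4)[OF G H] verts(4) strong]
    by (intro conjI impI) blast+
qed

end
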